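(* Let $f,g\in\mathrm{Hol}(\Delta,\mathbb{C})$ be the generators of one-parameter continuous semigroups $\{F_t\}_{t\ge 0}$ and $\{G_t\}_{t\ge 0}$ on the open unit disk $\Delta$, respectively. Define linear semigroups $\{A_t\}_{t\ge 0}$ and $\{B_t\}_{t\ge 0}$ of composition operators on $\mathrm{Hol}(\Delta,\mathbb{C})$ by $$A_t(h)=h\circ F_t,\qquad B_t(h)=h\circ G_t,\qquad t\ge 0,$$ whose generators are, respectively, the operators $$\Gamma_f(h)=h'f,\qquad \Gamma_g(h)=h'g.$$ Then the following are equivalent: (i) $F_t\circ G_s=G_s\circ F_t$ for all $s,t\ge 0$, i.e. the semigroups $\{F_t\}_{t\ge 0}$ and $\{G_t\}_{t\ge 0}$ are commuting; (ii) $A_t\circ B_s=B_s\circ A_t$ for all $s,t\ge 0$, i.e. the linear semigroups $\{A_t\}_{t\ge 0}$ and $\{B_t\}_{t\ge 0}$ are commuting; (iii) $\Gamma_f\circ\Gamma_g=\Gamma_g\circ\Gamma_f$, i.e. the linear semigroup generators $\Gamma_f$ and $\Gamma_g$ are commuting; (iv) the Lie commutator $[f,g]=f'g-g'f=0$; (v) $f=\alpha g$ for some $\alpha\in\mathbb{C}$.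
   Context: $\Delta=\{z\in\mathbb{C}:|z|<1\}$ and $\mathrm{Hol}(\Delta,\mathbb{C})$ is the space of all holomorphic functions $\Delta\to\mathbb{C}$. A family $\{F_t\}_{t\ge 0}$ of holomorphic self-mappings of $\Delta$ is a one-parameter continuous semigroup on $\Delta$ if $F_t(F_s(z))=F_{t+s}(z)$ for all $t,s\ge 0$ and $\lim_{t\to 0^+}F_t(z)=z$ for all $z\in\Delta$. For such a family the limit $f(z)=\lim_{t\to 0^+}\frac{z-F_t(z)}{t}$ exists for every $z\in\Delta$ and defines a holomorphic function $f:\Delta\to\mathbb{C}$, called the generator of the semigroup; $u(t,z)=F_t(z)$ is the unique solution of $\partial u/\partial t+f(u)=0$, $u(0,z)=z$.
   Formalization: The implication from (iv) to (v) is stated only when g is not identically zero on the disc, since for g = 0 and f(z) = z conditions (i)–(iv) hold but (v) fails. *)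

theory Defs
  imports "HOL-Complex_Analysis.Complex_Analysis"
begin

abbreviation unit_disc :: "complex set" where
  "unit_disc \<equiv> ball 0 1"

text \<open>
  A holomorphic function on the disc is represented by any total function that is holomorphic on
  the disc; values outside are irrelevant, so all equalities below are restricted to the disc.
\<close>

definition Hol_disc :: "(complex \<Rightarrow> complex) set" where
  "Hol_disc = {h. h holomorphic_on unit_disc}"

definition one_param_semigroup :: "(real \<Rightarrow> complex \<Rightarrow> complex) \<Rightarrow> bool" where
  "one_param_semigroup F \<longleftrightarrow>
     (\<forall>t\<ge>0. F t \<in> Hol_disc \<and> F t ` unit_disc \<subseteq> unit_disc) \<and>
     (\<forall>t\<ge>0. \<forall>s\<ge>0. \<forall>z\<in>unit_disc. F t (F s z) = F (t + s) z) \<and>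
     (\<forall>z\<in>unit_disc. ((\<lambda>t. F t z) \<longlongrightarrow> z) (at_right 0))"

definition semigroup_generator ::
    "(real \<Rightarrow> complex \<Rightarrow> complex) \<Rightarrow> (complex \<Rightarrow> complex) \<Rightarrow> bool" where
  "semigroup_generator F f \<longleftrightarrow>
     (\<forall>z\<in>unit_disc. ((\<lambda>t. (z - F t z) / of_real t) \<longlongrightarrow> f z) (at_right 0))"

type_synonym hol_operator = "(complex \<Rightarrow> complex) \<Rightarrow> complex \<Rightarrow> complex"

definition composition_semigroup :: "(real \<Rightarrow> complex \<Rightarrow> complex) \<Rightarrow> real \<Rightarrow> hol_operator" where
  "composition_semigroup F t h = h \<circ> F t"

definition Gamma_op :: "(complex \<Rightarrow> complex) \<Rightarrow> hol_operator" where
  "Gamma_op f h = (\<lambda>z. deriv h z * f z)"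

text \<open>
  The generator of a linear semigroup, with the same sign convention \<open>(h - A\<^sub>t h) / t\<close> as for
  semigroups of self-maps; the limit is taken in the usual topology on the space of holomorphic
  functions, uniform convergence on compact subsets of the disc.
\<close>

definition linear_semigroup_generator :: "(real \<Rightarrow> hol_operator) \<Rightarrow> hol_operator \<Rightarrow> bool" where
  "linear_semigroup_generator A \<Gamma> \<longleftrightarrow>
     (\<forall>h\<in>Hol_disc. \<forall>K. compact K \<longrightarrow> K \<subseteq> unit_disc \<longrightarrow>
        uniform_limit K (\<lambda>t z. (h z - A t h z) / of_real t) (\<Gamma> h) (at_right 0))"

definition operators_commute :: "hol_operator \<Rightarrow> hol_operator \<Rightarrow> bool" where
  "operators_commute S T \<longleftrightarrow>
     (\<forall>h\<in>Hol_disc. \<forall>z\<in>unit_disc. S (T h) z = T (S h) z)"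

definition lie_commutator ::
    "(complex \<Rightarrow> complex) \<Rightarrow> (complex \<Rightarrow> complex) \<Rightarrow> complex \<Rightarrow> complex" where
  "lie_commutator f g z = deriv f z * g z - deriv g z * f z"

end

theory Submission
  imports Defs
begin

text \<open>
  By Cauchy's estimate all holomorphic self-maps of the disc share a Lipschitz constant on each
  smaller disc. Hence a semigroup is jointly continuous in time and space, and \<open>h \<circ> F\<^sub>t\<close> has the right
  derivative \<open>- (h' f) \<circ> F\<^sub>t\<close> in \<open>t\<close>; the mean value inequality for right derivatives turns the
  pointwise generator into one that is uniform on compact sets.

  If the flows commute, differentiating \<open>F\<^sub>t \<circ> G\<^sub>s = G\<^sub>s \<circ> F\<^sub>t\<close> in \<open>s\<close> at \<open>0\<close> gives
  \<open>F\<^sub>t' g = g \<circ> F\<^sub>t\<close>, and differentiating this in \<open>t\<close> at \<open>0\<close> gives \<open>f' g = g' f\<close>. Conversely, if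
  \<open>f' g = g' f\<close>, then either \<open>f = 0\<close> and every \<open>F\<^sub>t\<close> is the identity, or \<open>g = \<beta> f\<close>, and
  \<open>F\<^sub>t' f = f \<circ> F\<^sub>t\<close> yields \<open>F\<^sub>t' g = g \<circ> F\<^sub>t\<close>. Then \<open>s \<mapsto> F\<^sub>t (G\<^sub>s z)\<close> solves \<open>u' = - g (u)\<close>, so it
  is \<open>s \<mapsto> G\<^sub>s (F\<^sub>t z)\<close> by uniqueness.
\<close>

section \<open>Right derivatives and self-maps of the disc\<close>

text \<open>Links derivatives within a half-line to the one-sided difference quotients in which
  generators are defined.\<close>

lemma has_vector_derivative_right_iff:
  fixes \<phi> :: "real \<Rightarrow> 'a::real_normed_vector"
  shows "(\<phi> has_vector_derivative d) (at t within {t..}) \<longleftrightarrow>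
    ((\<lambda>h. (\<phi> (t + h) - \<phi> t) /\<^sub>R h) \<longlongrightarrow> d) (at_right 0)"
proof -
  have "(\<phi> has_vector_derivative d) (at t within {t..}) \<longleftrightarrow>
      ((\<lambda>x. (\<phi> x - (\<phi> t + (x - t) *\<^sub>R d)) /\<^sub>R norm (x - t)) \<longlongrightarrow> 0) (at_right t)"
    by (simp add: has_vector_derivative_def has_derivative_within at_within_Ici_at_right
        bounded_linear_scaleR_left divide_inverse)
  also have "\<dots> \<longleftrightarrow>
      ((\<lambda>h. (\<phi> (h + t) - (\<phi> t + h *\<^sub>R d)) /\<^sub>R norm h) \<longlongrightarrow> 0) (at_right 0)"
    by (subst filterlim_at_right_to_0) simp
  also have "\<dots> \<longleftrightarrow> ((\<lambda>h. (\<phi> (t + h) - \<phi> t) /\<^sub>R h - d) \<longlongrightarrow> 0) (at_right 0)"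
    by (intro tendsto_cong eventually_at_rightI[of 0 1])
       (auto simp: add.commute algebra_simps scaleR_diff_right)
  also have "\<dots> \<longleftrightarrow> ((\<lambda>h. (\<phi> (t + h) - \<phi> t) /\<^sub>R h) \<longlongrightarrow> d) (at_right 0)"
    by (rule LIM_zero_iff)
  finally show ?thesis .
qed

text \<open>
  Only right derivatives are assumed, because the generator of a semigroup is a one-sided limit.
  The last point at which \<open>\<phi>\<close> stays within slope \<open>K > M\<close> of its initial value must be \<open>b\<close>.
\<close>

lemma norm_diff_le_right_derivative_bound:
  fixes \<phi> :: "real \<Rightarrow> 'a::real_normed_vector"
  assumes "a \<le> b" and cont: "continuous_on {a..b} \<phi>"
    and deriv: "\<And>t. a \<le> t \<Longrightarrow> t < b \<Longrightarrow> (\<phi> has_vector_derivative \<phi>' t) (at t within {t..})"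
    and bound: "\<And>t. a \<le> t \<Longrightarrow> t < b \<Longrightarrow> norm (\<phi>' t) \<le> M"
  shows "norm (\<phi> b - \<phi> a) \<le> M * (b - a)"
proof (rule ccontr)
  assume contra: "\<not> norm (\<phi> b - \<phi> a) \<le> M * (b - a)"
  then have "a < b" using \<open>a \<le> b\<close> by (cases "a = b") auto
  with contra have "M < norm (\<phi> b - \<phi> a) / (b - a)" by (simp add: field_simps)
  \<comment> \<open>The slack between \<open>M\<close> and \<open>K\<close> makes the bound at
    \<open>c\<close> strict, so it passes from the right derivative to difference quotients over
    short steps.\<close>
  then obtain K where "M < K" and "K < norm (\<phi> b - \<phi> a) / (b - a)" using dense by blast
  then have K: "K * (b - a) < norm (\<phi> b - \<phi> a)" using \<open>a < b\<close> by (simp add: field_simps)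
  define C where "C = {t \<in> {a..b}. norm (\<phi> t - \<phi> a) \<le> K * (t - a)}"
  have "closed C" unfolding C_def
    by (intro continuous_on_closed_Collect_le continuous_intros cont closed_atLeastAtMost)
  moreover have "C \<subseteq> {a..b}" by (auto simp: C_def)
  ultimately have "compact C"
    using bounded_subset[OF bounded_closed_interval] compact_eq_bounded_closed by blast
  moreover have "a \<in> C" using \<open>a \<le> b\<close> by (simp add: C_def)
  ultimately obtain c where c: "c \<in> C" and c_max: "\<And>t. t \<in> C \<Longrightarrow> t \<le> c"
    using compact_attains_sup[of C] by blast
  have ac: "a \<le> c" "c \<le> b" and c_le: "norm (\<phi> c - \<phi> a) \<le> K * (c - a)"
    using c by (auto simp: C_def)
  have "c < b" using ac c_le K by (cases "c = b") auto
  have "((\<lambda>h. norm ((\<phi> (c + h) - \<phi> c) /\<^sub>R h)) \<longlongrightarrow> norm (\<phi>' c)) (at_right 0)"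
    using deriv[OF ac(1) \<open>c < b\<close>] by (intro tendsto_norm) (simp add: has_vector_derivative_right_iff)
  moreover have "norm (\<phi>' c) < K" using bound[OF ac(1) \<open>c < b\<close>] \<open>M < K\<close> by simp
  ultimately have "\<forall>\<^sub>F h in at_right 0. norm ((\<phi> (c + h) - \<phi> c) /\<^sub>R h) < K"
    by (rule order_tendstoD(2))
  moreover have "\<forall>\<^sub>F h in at_right 0. h \<in> {0<..<b - c}"
    using \<open>c < b\<close> by (intro eventually_at_right_real) simp
  ultimately have "\<forall>\<^sub>F h in at_right 0. norm ((\<phi> (c + h) - \<phi> c) /\<^sub>R h) < K \<and> h \<in> {0<..<b - c}"
    by (rule eventually_conj)
  then obtain h where h: "norm ((\<phi> (c + h) - \<phi> c) /\<^sub>R h) < K" "0 < h" "h < b - c"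
    using eventually_happens'[OF trivial_limit_at_right_real] by fastforce
  then have "norm (\<phi> (c + h) - \<phi> c) / h < K" by (simp add: divide_inverse mult.commute)
  then have "norm (\<phi> (c + h) - \<phi> c) \<le> K * h" using h by (simp add: pos_divide_less_eq)
  then have "norm (\<phi> (c + h) - \<phi> a) \<le> K * (c + h - a)"
    using c_le norm_triangle_ineq[of "\<phi> (c + h) - \<phi> c" "\<phi> c - \<phi> a"] by (simp add: algebra_simps)
  then have "c + h \<in> C" using h ac by (simp add: C_def)
  with c_max[of "c + h"] h show False by simp
qed

text \<open>Cauchy's inequality on discs of radius \<open>(1 - r) / 2\<close> bounds the derivative,
  because \<open>H\<close> is bounded by 1. The constant does not depend on \<open>H\<close>, so it
  serves all maps of a semigroup at once.\<close>

lemma disc_self_map_lipschitz: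
  assumes hol: "H holomorphic_on ball 0 1" and maps: "H ` ball 0 1 \<subseteq> ball (0::complex) 1"
    and "r < 1"
  shows "(2 / (1 - r))-lipschitz_on (cball 0 r) H"
proof (rule lipschitz_onI)
  show "0 \<le> 2 / (1 - r)" using \<open>r < 1\<close> by simp
  fix x y :: complex assume xy: "x \<in> cball 0 r" "y \<in> cball 0 r"
  have deriv_bound: "norm (deriv H z) \<le> 2 / (1 - r)" if "z \<in> cball 0 r" for z
  proof -
    \<comment> \<open>Half the distance from \<open>cball 0 r\<close> to the unit circle keeps the
      closed disc inside the open one.\<close>
    have sub: "cball z ((1 - r) / 2) \<subseteq> ball 0 1"
    proof
      fix w assume "w \<in> cball z ((1 - r) / 2)"
      then have "norm (w - z) \<le> (1 - r) / 2" by (simp add: dist_norm norm_minus_commute)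
      moreover have "norm w \<le> norm (w - z) + norm z" by (metis diff_add_cancel norm_triangle_ineq)
      ultimately show "w \<in> ball 0 1" using that \<open>r < 1\<close> by simp
    qed
    have "norm ((deriv ^^ 1) H z) \<le> fact 1 * 1 / ((1 - r) / 2) ^ 1"
    proof (rule Cauchy_inequality)
      show "H holomorphic_on ball z ((1 - r) / 2)"
        using sub by (intro holomorphic_on_subset[OF hol]) auto
      show "continuous_on (cball z ((1 - r) / 2)) H"
        using sub hol by (meson continuous_on_subset holomorphic_on_imp_continuous_on)
      fix x assume "norm (z - x) = (1 - r) / 2"
      then have "x \<in> ball 0 1" by (intro subsetD[OF sub]) (simp add: dist_norm)
      with maps have "H x \<in> ball 0 1" by blast
      then show "norm (H x) \<le> 1" by simp
    qed (use \<open>r < 1\<close> in simp)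
    then show ?thesis by simp
  qed
  have "norm (H x - H y) \<le> 2 / (1 - r) * norm (x - y)"
  proof (rule field_differentiable_bound[OF convex_cball _ deriv_bound xy])
    fix z :: complex assume "z \<in> cball 0 r"
    then have "z \<in> ball 0 1" using \<open>r < 1\<close> by simp
    then show "(H has_field_derivative deriv H z) (at z within cball 0 r)"
      by (rule has_field_derivative_at_within[OF holomorphic_derivI[OF hol open_ball]])
  qed
  then show "dist (H x) (H y) \<le> 2 / (1 - r) * dist x y" by (simp add: dist_norm)
qed

lemma compact_subset_unit_disc_cball:
  fixes K :: "'a::real_normed_vector set"
  assumes "compact K" "K \<subseteq> ball 0 1"
  obtains r where "0 < r" "r < 1" "K \<subseteq> cball 0 r"
proof (cases "K = {}")
  case True
  then show ?thesis using that[of "1/2"] by simp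
next
  case False
  then obtain z where z: "z \<in> K" "\<And>w. w \<in> K \<Longrightarrow> norm w \<le> norm z"
    using continuous_attains_sup[OF assms(1), of norm] continuous_on_norm_id by auto
  have "norm z < 1" using z assms(2) by force
  show ?thesis
  proof (rule that[of "(1 + norm z) / 2"])
    show "0 < (1 + norm z) / 2" by (simp add: add_pos_nonneg)
    show "(1 + norm z) / 2 < 1" using \<open>norm z < 1\<close> by simp
    show "K \<subseteq> cball 0 ((1 + norm z) / 2)" using z \<open>norm z < 1\<close> by fastforce
  qed
qed

section \<open>Semigroups on the disc\<close>

lemma has_vector_derivative_holomorphic_comp:
  assumes h: "h holomorphic_on unit_disc" and "u s \<in> unit_disc"
    and u: "(u has_vector_derivative u') (at s within T)"
  shows "((\<lambda>s. h (u s)) has_vector_derivative u' * deriv h (u s)) (at s within T)"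
  using field_vector_diff_chain_within[OF u
      has_field_derivative_at_within[OF holomorphic_derivI[OF h open_ball \<open>u s \<in> unit_disc\<close>]]]
  by (simp add: o_def)

locale disc_semigroup =
  fixes F :: "real \<Rightarrow> complex \<Rightarrow> complex" and f :: "complex \<Rightarrow> complex"
  assumes semigroup: "one_param_semigroup F"
    and generator: "semigroup_generator F f"
    and generator_holomorphic: "f holomorphic_on unit_disc"
begin

lemma flow_holomorphic: "0 \<le> t \<Longrightarrow> F t holomorphic_on unit_disc"
  and flow_maps: "0 \<le> t \<Longrightarrow> F t ` unit_disc \<subseteq> unit_disc"
  and flow_add: "0 \<le> t \<Longrightarrow> 0 \<le> s \<Longrightarrow> z \<in> unit_disc \<Longrightarrow> F t (F s z) = F (t + s) z"
  and flow_tendsto: "z \<in> unit_disc \<Longrightarrow> ((\<lambda>t. F t z) \<longlongrightarrow> z) (at_right 0)"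
  using semigroup unfolding one_param_semigroup_def Hol_disc_def by blast+

lemma flow_in_disc: "0 \<le> t \<Longrightarrow> z \<in> unit_disc \<Longrightarrow> F t z \<in> unit_disc"
  using flow_maps by blast

lemma flow_field_derivative:
  "0 \<le> t \<Longrightarrow> z \<in> unit_disc \<Longrightarrow> (F t has_field_derivative deriv (F t) z) (at z)"
  using holomorphic_derivI[OF flow_holomorphic open_ball] .

lemma flow_lipschitz: "0 \<le> t \<Longrightarrow> r < 1 \<Longrightarrow> (2 / (1 - r))-lipschitz_on (cball 0 r) (F t)"
  by (rule disc_self_map_lipschitz[OF flow_holomorphic flow_maps])

text \<open>The axioms prescribe only the limit at 0 from the right. The value at 0 follows by
  letting \<open>s\<close> tend to 0 in \<open>F 0 (F s z) = F s z\<close>, with \<open>F 0\<close>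
  continuous at \<open>z\<close>.\<close>

lemma flow_zero:
  assumes z: "z \<in> unit_disc"
  shows "F 0 z = z"
proof -
  have "isCont (F 0) z"
    using flow_field_derivative[OF order_refl z] by (rule DERIV_isCont)
  then have "((\<lambda>s. F 0 (F s z)) \<longlongrightarrow> F 0 z) (at_right 0)"
    using flow_tendsto[OF z] by (rule isCont_tendsto_compose)
  moreover have "((\<lambda>s. F 0 (F s z)) \<longlongrightarrow> z) (at_right 0)"
  proof (rule Lim_transform_eventually[OF flow_tendsto[OF z]])
    show "\<forall>\<^sub>F s in at_right 0. F s z = F 0 (F s z)"
      using z by (intro eventually_at_rightI[of 0 1]) (auto simp: flow_add)
  qed
  ultimately show ?thesis
    using tendsto_unique[OF trivial_limit_at_right_real] by blast
qed

text \<open>Continuity at time 0 spreads to all times through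
  \<open>F (s + h) z = F s (F h z)\<close> and the common Lipschitz constant.\<close>

lemma flow_continuous_in_time:
  assumes z: "z \<in> unit_disc"
  shows "continuous_on {0..} (\<lambda>t. F t z)"
proof -
  define r where "r = (1 + norm z) / 2"
  have r: "norm z < r" "r < 1" using z by (auto simp: r_def)
  define L where "L = 2 / (1 - r)"
  have "0 < L" using r by (simp add: L_def)
  show ?thesis unfolding continuous_on_iff
  proof (intro ballI allI impI)
    fix t e :: real assume "t \<in> {0..}" "0 < e"
    \<comment> \<open>The first bound absorbs the factor \<open>L\<close>; the second keeps
      \<open>F h z\<close> in \<open>cball 0 r\<close>, where \<open>L\<close> is valid.\<close>
    define e' where "e' = min (e / L) (r - norm z)"
    have "0 < e'" using \<open>0 < e\<close> \<open>0 < L\<close> r by (simp add: e'_def)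
    with flow_tendsto[OF z] have "\<forall>\<^sub>F h in at_right 0. dist (F h z) z < e'"
      by (simp add: tendsto_iff)
    then obtain d where "0 < d" and d: "\<And>h. 0 < h \<Longrightarrow> h < d \<Longrightarrow> dist (F h z) z < e'"
      unfolding eventually_at_right_field by auto
    have close: "dist (F (s + h) z) (F s z) < e" if "0 \<le> s" "0 \<le> h" "h < d" for s h
    proof -
      have he: "dist (F h z) z < e'"
        using that d[of h] \<open>0 < e'\<close> flow_zero[OF z] by (cases "h = 0") auto
      have "F h z \<in> cball 0 r"
      proof -
        have "norm (F h z) \<le> norm (F h z - z) + norm z" by (metis diff_add_cancel norm_triangle_ineq)
        then show ?thesis using he by (simp add: e'_def dist_norm)
      qed
      moreover have "z \<in> cball 0 r" using r by simp
      ultimately have "dist (F s (F h z)) (F s z) \<le> L * dist (F h z) z"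
        unfolding L_def using lipschitz_onD[OF flow_lipschitz[OF \<open>0 \<le> s\<close> r(2)]] by blast
      also have "\<dots> < L * (e / L)" using he \<open>0 < L\<close> by (intro mult_strict_left_mono) (simp_all add: e'_def)
      finally show ?thesis using that z \<open>0 < L\<close> by (simp add: flow_add)
    qed
    \<comment> \<open>The estimate \<open>close\<close> is uniform in its starting time, so the
      earlier of the two times can be the base; this also gives continuity from the left.\<close>
    have "dist (F s z) (F t z) < e" if "s \<in> {0..}" "dist s t < d" for s :: real
    proof (cases "t \<le> s")
      case True
      then show ?thesis using close[of t "s - t"] that \<open>t \<in> {0..}\<close> by (simp add: dist_real_def)
    next
      case False
      then show ?thesis
        using close[of s "t - s"] that \<open>t \<in> {0..}\<close> by (simp add: dist_real_def dist_commute)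
    qed
    with \<open>0 < d\<close> show "\<exists>d>0. \<forall>s\<in>{0..}. dist s t < d \<longrightarrow> dist (F s z) (F t z) < e" by blast
  qed
qed

text \<open>Continuity in time becomes joint continuity because the Lipschitz constant in space is
  locally uniform in time.\<close>

lemma flow_continuous: "continuous_on ({0..} \<times> unit_disc) (\<lambda>(t, z). F t z)"
proof (rule continuous_on_TimesI)
  show "local_lipschitz {0..} unit_disc F"
  proof (rule local_lipschitzI)
    fix t :: real and z :: complex assume "z \<in> unit_disc"
    then have u: "0 < (1 - norm z) / 2" by simp
    have "cball z ((1 - norm z) / 2) \<subseteq> cball 0 ((1 + norm z) / 2)"
    proof
      fix w assume "w \<in> cball z ((1 - norm z) / 2)"
      then show "w \<in> cball 0 ((1 + norm z) / 2)"
        using norm_triangle_ineq2[of w z] by (simp add: dist_norm norm_minus_commute field_simps)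
    qed
    then have "(2 / (1 - (1 + norm z) / 2))-lipschitz_on (cball z ((1 - norm z) / 2) \<inter> unit_disc) (F s)"
      if "0 \<le> s" for s
      using that u by (intro lipschitz_on_subset[OF flow_lipschitz]) auto
    with u show "\<exists>u>0. \<exists>L. \<forall>s\<in>cball t u \<inter> {0..}. L-lipschitz_on (cball z u \<inter> unit_disc) (F s)"
      by (intro exI[of _ "(1 - norm z) / 2"] exI conjI ballI) auto
  qed
  show "continuous_on {0..} (\<lambda>t. F t z)" if "z \<in> unit_disc" for z
    using that by (rule flow_continuous_in_time)
qed

text \<open>By the semigroup law, the quotient at time \<open>t\<close> is the quotient at time 0 of
  the orbit that starts at \<open>F t z\<close>.\<close>

lemma flow_right_derivative:
  assumes "0 \<le> t" "z \<in> unit_disc"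
  shows "((\<lambda>s. F s z) has_vector_derivative - f (F t z)) (at t within {t..})"
  unfolding has_vector_derivative_right_iff
proof -
  have "((\<lambda>h. - ((F t z - F h (F t z)) / of_real h)) \<longlongrightarrow> - f (F t z)) (at_right 0)"
    using generator flow_in_disc[OF assms] unfolding semigroup_generator_def
    by (intro tendsto_minus) blast
  then show "((\<lambda>h. (F (t + h) z - F t z) /\<^sub>R h) \<longlongrightarrow> - f (F t z)) (at_right 0)"
  proof (rule Lim_transform_eventually)
    show "\<forall>\<^sub>F h in at_right 0. - ((F t z - F h (F t z)) / of_real h) = (F (t + h) z - F t z) /\<^sub>R h"
      using assms
      by (intro eventually_at_rightI[of 0 1])
         (simp_all add: flow_add scaleR_conv_of_real divide_inverse mult.commute add.commute[of t]
           flip: mult_minus_right)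
  qed
qed

text \<open>Both sides are, up to sign, the right derivative of \<open>F\<^sub>t \<circ> F\<^sub>s = F\<^sub>t\<^sub>+\<^sub>s\<close> at \<open>s = 0\<close>.\<close>

lemma flow_generator_equivariant:
  assumes "0 \<le> t" "z \<in> unit_disc"
  shows "deriv (F t) z * f z = f (F t z)"
proof -
  have "((\<lambda>s. F t (F s z)) has_vector_derivative - f z * deriv (F t) z) (at 0 within {0..})"
    using has_vector_derivative_holomorphic_comp[OF flow_holomorphic[OF assms(1)] flow_in_disc
        flow_right_derivative, of 0 z] assms flow_zero[OF assms(2)] by simp
  moreover have "((\<lambda>s. F t (F s z)) has_vector_derivative - f (F t z)) (at 0 within {0..})"
  proof -
    have "((\<lambda>s. F (t + s) z) has_vector_derivative - f (F t z)) (at 0 within {0..})"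
      using flow_right_derivative[OF assms] by (simp add: has_vector_derivative_right_iff)
    then show ?thesis
      by (rule has_vector_derivative_transform[rotated 2]) (use assms in \<open>auto simp: flow_add\<close>)
  qed
  ultimately have "- f z * deriv (F t) z = - f (F t z)"
    by (rule vector_derivative_unique_within[rotated])
       (simp add: at_within_Ici_at_right)
  then show ?thesis by (simp add: mult.commute)
qed

text \<open>The error of the difference quotient at time \<open>t\<close> is at most the supremum of
  \<open>norm (q z - q (F s z))\<close> over \<open>s < t\<close>, by the mean value inequality.
  Uniform continuity on \<open>{0..1} \<times> K\<close> makes it small for all \<open>z\<close> in
  \<open>K\<close> together.\<close>

lemma composition_generator: "linear_semigroup_generator (composition_semigroup F) (Gamma_op f)"
  unfolding linear_semigroup_generator_def
proof (intro ballI allI impI)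
  fix h and K :: "complex set"
  assume "h \<in> Hol_disc" and K: "compact K" "K \<subseteq> unit_disc"
  then have h: "h holomorphic_on unit_disc" by (simp add: Hol_disc_def)
  define q where "q = (\<lambda>z. deriv h z * f z)"
  have "q holomorphic_on unit_disc"
    unfolding q_def by (intro holomorphic_intros h generator_holomorphic) simp
  then have q_cont: "continuous_on unit_disc q" by (rule holomorphic_on_imp_continuous_on)
  have h_cont: "continuous_on unit_disc h" using h by (rule holomorphic_on_imp_continuous_on)
  have "continuous_on ({0..1} \<times> K) (\<lambda>p. q (case p of (t, z) \<Rightarrow> F t z))"
    using K(2) flow_in_disc
    by (intro continuous_on_compose2[OF q_cont] continuous_on_subset[OF flow_continuous]) auto
  then have unif: "uniformly_continuous_on ({0..1} \<times> K) (\<lambda>p. q (case p of (t, z) \<Rightarrow> F t z))"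
    using K(1) by (intro compact_uniformly_continuous compact_Times compact_Icc)
  show "uniform_limit K (\<lambda>t z. (h z - composition_semigroup F t h z) / of_real t) (Gamma_op f h) (at_right 0)"
    unfolding uniform_limit_iff
  proof (intro allI impI)
    fix e :: real assume "0 < e"
    then obtain d where "0 < d"
      and d: "\<And>p p'. p \<in> {0..1} \<times> K \<Longrightarrow> p' \<in> {0..1} \<times> K \<Longrightarrow> dist p' p < d \<Longrightarrow>
        dist (q (case p' of (t, z) \<Rightarrow> F t z)) (q (case p of (t, z) \<Rightarrow> F t z)) < e / 2"
      using unif unfolding uniformly_continuous_on_def by (meson half_gt_zero)
    have est: "dist ((h z - h (F t z)) / of_real t) (q z) < e"
      if "0 < t" "t < min d 1" "z \<in> K" for t z
    proof -
      have z: "z \<in> unit_disc" using that K by blast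
      \<comment> \<open>Up to the constant \<open>h z\<close>, this is the deviation of
        \<open>h (F s z)\<close> from its first-order expansion
        \<open>h z - s * q z\<close>.\<close>
      define \<phi> where "\<phi> = (\<lambda>s. h (F s z) + of_real s * q z)"
      have "norm (\<phi> t - \<phi> 0) \<le> e / 2 * (t - 0)"
      proof (rule norm_diff_le_right_derivative_bound)
        show "continuous_on {0..t} \<phi>"
          unfolding \<phi>_def using flow_in_disc z
          by (intro continuous_intros continuous_on_compose2[OF h_cont]
              continuous_on_subset[OF flow_continuous_in_time]) auto
        fix s assume s: "0 \<le> s" "s < t"
        have "((\<lambda>s. h (F s z)) has_vector_derivative - q (F s z)) (at s within {s..})"
          using has_vector_derivative_holomorphic_comp[OF h flow_in_disc flow_right_derivative] s z
          by (simp add: q_def mult.commute)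
        moreover have "((\<lambda>s. of_real s * q z) has_vector_derivative q z) (at s within {s..})"
          by (auto intro!: derivative_eq_intros)
        ultimately show "(\<phi> has_vector_derivative (- q (F s z) + q z)) (at s within {s..})"
          unfolding \<phi>_def by (rule has_vector_derivative_add)
        have "dist (q (F s z)) (q (F 0 z)) < e / 2"
          using d[of "(0, z)" "(s, z)"] s that by (simp add: dist_Pair_Pair)
        then show "norm (- q (F s z) + q z) \<le> e / 2"
          using flow_zero[OF z] by (simp add: dist_norm norm_minus_commute)
      qed (use that in simp)
      then have "norm (h (F t z) - h z + of_real t * q z) \<le> e / 2 * t"
        using flow_zero[OF z] by (simp add: \<phi>_def add_diff_eq diff_add_eq)
      moreover have "(h z - h (F t z)) / of_real t - q z = - (h (F t z) - h z + of_real t * q z) / of_real t"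
        using that by (simp add: field_simps)
      ultimately have "norm ((h z - h (F t z)) / of_real t - q z) \<le> e / 2"
        using that by (simp only: norm_divide norm_minus_cancel norm_of_real) (simp add: pos_divide_le_eq)
      then show ?thesis using \<open>0 < e\<close> by (simp add: dist_norm)
    qed
    show "\<forall>\<^sub>F t in at_right 0. \<forall>z\<in>K.
        dist ((h z - composition_semigroup F t h z) / of_real t) (Gamma_op f h z) < e"
      using est \<open>0 < d\<close>
      by (intro eventually_at_rightI[of 0 "min d 1"])
         (auto simp: composition_semigroup_def Gamma_op_def q_def)
  qed
qed

text \<open>
  No Gronwall estimate is needed: \<open>s \<mapsto> F\<^sub>S\<^sub>-\<^sub>s (u s)\<close> has right derivative \<open>0\<close>, since \<open>u (s + h)\<close> and
  \<open>F\<^sub>h (u s)\<close> agree up to \<open>o(h)\<close> and the maps \<open>F\<^sub>t\<close> share a Lipschitz constant on compact sets.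
\<close>

lemma flow_unique:
  assumes "0 \<le> S" and u_cont: "continuous_on {0..S} u"
    and u_disc: "u ` {0..S} \<subseteq> unit_disc"
    and u_deriv: "\<And>s. 0 \<le> s \<Longrightarrow> s < S \<Longrightarrow> (u has_vector_derivative - f (u s)) (at s within {s..})"
  shows "u S = F S (u 0)"
proof -
  have "compact (u ` {0..S})" by (intro compact_continuous_image u_cont compact_Icc)
  then obtain r0 where r0: "0 < r0" "r0 < 1" "u ` {0..S} \<subseteq> cball 0 r0"
    using compact_subset_unit_disc_cball u_disc by metis
  \<comment> \<open>The path \<open>u\<close> stays in \<open>cball 0 r0\<close>; the larger radius
    leaves room for the nearby points \<open>F h (u s)\<close>.\<close>
  define r where "r = (1 + r0) / 2"
  have r: "r0 < r" "r < 1" using r0 by (auto simp: r_def)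
  define L where "L = 2 / (1 - r)"
  have "0 < L" using r by (simp add: L_def)
  define W where "W = (\<lambda>s. F (S - s) (u s))"
  have "norm (W S - W 0) \<le> 0 * (S - 0)"
  proof (rule norm_diff_le_right_derivative_bound[OF \<open>0 \<le> S\<close>])
    have "continuous_on {0..S} (\<lambda>s. case (S - s, u s) of (t, z) \<Rightarrow> F t z)"
      using u_disc
      by (intro continuous_on_compose2[OF flow_continuous] continuous_intros u_cont) auto
    then show "continuous_on {0..S} W" by (simp add: W_def)
    fix s assume s: "0 \<le> s" "s < S"
    have us: "u s \<in> unit_disc" using u_disc s by (auto simp: image_subset_iff)
    have us_r: "norm (u s) \<le> r0" using r0(3) s by (auto simp: image_subset_iff)
    have u_lim: "((\<lambda>h. (u (s + h) - u s) /\<^sub>R h) \<longlongrightarrow> - f (u s)) (at_right 0)"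
      using u_deriv[OF s] by (simp add: has_vector_derivative_right_iff)
    have F_lim: "((\<lambda>h. (F h (u s) - u s) /\<^sub>R h) \<longlongrightarrow> - f (u s)) (at_right 0)"
      using flow_right_derivative[OF order_refl us] flow_zero[OF us]
      by (simp add: has_vector_derivative_right_iff)
    have "((\<lambda>h. L * norm ((u (s + h) - u s) /\<^sub>R h - (F h (u s) - u s) /\<^sub>R h)) \<longlongrightarrow> 0) (at_right 0)"
      using tendsto_mult_right_zero[OF tendsto_norm_zero[OF tendsto_diff[OF u_lim F_lim, simplified]]] by simp
    moreover have "\<forall>\<^sub>F h in at_right 0. norm ((W (s + h) - W s) /\<^sub>R h) \<le>
        L * norm ((u (s + h) - u s) /\<^sub>R h - (F h (u s) - u s) /\<^sub>R h)"
    proof -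
      have "\<forall>\<^sub>F h in at_right 0. dist (F h (u s)) (u s) < r - r0"
        using flow_tendsto[OF us] r by (simp add: tendsto_iff)
      moreover have "\<forall>\<^sub>F h in at_right 0. h \<in> {0<..<S - s}"
        using s by (intro eventually_at_right_real) simp
      ultimately show ?thesis
      proof eventually_elim
        fix h assume near: "dist (F h (u s)) (u s) < r - r0" and h: "h \<in> {0<..<S - s}"
        have "norm (F h (u s)) \<le> r"
          using near us_r norm_triangle_ineq2[of "F h (u s)" "u s"] by (simp add: dist_norm)
        moreover have "norm (u (s + h)) \<le> r"
          using r0(3)[unfolded image_subset_iff, rule_format, of "s + h"] r s h by simp
        ultimately have "dist (F (S - (s + h)) (u (s + h))) (F (S - (s + h)) (F h (u s)))
            \<le> L * dist (u (s + h)) (F h (u s))"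
          unfolding L_def using h by (intro lipschitz_onD[OF flow_lipschitz[OF _ r(2)]]) auto
        \<comment> \<open>Both \<open>W (s + h)\<close> and \<open>W s\<close> are thus values of
          the single map \<open>F (S - (s + h))\<close>, so its Lipschitz bound applies.\<close>
        moreover have "F (S - (s + h)) (F h (u s)) = W s"
          using h us by (subst flow_add) (auto simp: W_def)
        ultimately have "norm (W (s + h) - W s) \<le> L * norm (u (s + h) - F h (u s))"
          by (simp add: W_def dist_norm)
        then have "norm (W (s + h) - W s) / h \<le> L * norm (u (s + h) - F h (u s)) / h"
          using h by (intro divide_right_mono) auto
        moreover have "(u (s + h) - u s) /\<^sub>R h - (F h (u s) - u s) /\<^sub>R h = (u (s + h) - F h (u s)) /\<^sub>R h"
          by (simp add: algebra_simps)
        ultimately show "norm ((W (s + h) - W s) /\<^sub>R h) \<le>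
            L * norm ((u (s + h) - u s) /\<^sub>R h - (F h (u s) - u s) /\<^sub>R h)"
          using h by (simp add: divide_inverse mult_ac)
      qed
    qed
    ultimately have "((\<lambda>h. (W (s + h) - W s) /\<^sub>R h) \<longlongrightarrow> 0) (at_right 0)"
      by (rule Lim_null_comparison[rotated])
    then show "(W has_vector_derivative 0) (at s within {s..})"
      by (simp add: has_vector_derivative_right_iff)
  qed simp
  then have "W S = W 0" by simp
  moreover have "u S \<in> unit_disc" using u_disc \<open>0 \<le> S\<close> by (auto simp: image_subset_iff)
  ultimately show ?thesis by (simp add: W_def flow_zero)
qed

text \<open>With the identity as test function, \<open>composition_generator\<close> gives uniform
  convergence to \<open>f\<close> near \<open>z\<close>; locally uniform limits of holomorphic
  functions may be differentiated term by term.\<close>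

lemma flow_space_derivative_tendsto:
  assumes z: "z \<in> unit_disc"
  shows "((\<lambda>t. (1 - deriv (F t) z) / of_real t) \<longlongrightarrow> deriv f z) (at_right 0)"
proof -
  obtain r where r: "0 < r" "cball z r \<subseteq> unit_disc"
    using open_contains_cball z by (metis open_ball)
  have "uniform_limit (cball z r) (\<lambda>t w. (w - composition_semigroup F t (\<lambda>w. w) w) / of_real t)
      (Gamma_op f (\<lambda>w. w)) (at_right 0)"
    using composition_generator r(2) unfolding linear_semigroup_generator_def Hol_disc_def
    by (auto intro: holomorphic_on_ident)
  then have lim: "uniform_limit (cball z r) (\<lambda>t w. (w - F t w) / of_real t) f (at_right 0)"
    by (simp add: composition_semigroup_def Gamma_op_def)
  have "\<forall>\<^sub>F t in at_right 0. continuous_on (cball z r) (\<lambda>w. (w - F t w) / of_real t) \<and>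
      (\<forall>w\<in>ball z r. ((\<lambda>w. (w - F t w) / of_real t) has_field_derivative
        (1 - deriv (F t) w) / of_real t) (at w))"
  proof (rule eventually_at_rightI[of 0 1])
    fix t :: real assume t: "t \<in> {0<..<1}"
    show "continuous_on (cball z r) (\<lambda>w. (w - F t w) / of_real t) \<and>
      (\<forall>w\<in>ball z r. ((\<lambda>w. (w - F t w) / of_real t) has_field_derivative
        (1 - deriv (F t) w) / of_real t) (at w))"
    proof (intro conjI ballI)
      have "continuous_on unit_disc (F t)"
        using t flow_holomorphic by (simp add: holomorphic_on_imp_continuous_on)
      then show "continuous_on (cball z r) (\<lambda>w. (w - F t w) / of_real t)"
        using t by (intro continuous_intros continuous_on_subset[OF _ r(2)]) auto
      fix w assume "w \<in> ball z r"
      then have "w \<in> unit_disc" using r(2) ball_subset_cball by blast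
      then show "((\<lambda>w. (w - F t w) / of_real t) has_field_derivative
        (1 - deriv (F t) w) / of_real t) (at w)"
        using t by (intro DERIV_cdivide DERIV_diff DERIV_ident flow_field_derivative) auto
    qed
  qed simp
  from has_complex_derivative_uniform_limit[OF this lim trivial_limit_at_right_real r(1)]
  obtain f' where f': "(f has_field_derivative f' z) (at z)"
    "((\<lambda>t. (1 - deriv (F t) z) / of_real t) \<longlongrightarrow> f' z) (at_right 0)"
    using r(1) by (metis centre_in_ball)
  then show ?thesis using DERIV_imp_deriv by metis
qed

text \<open>A constant path solves the flow equation when \<open>f\<close> vanishes, so uniqueness
  applies.\<close>

lemma flow_trivial:
  assumes "\<And>z. z \<in> unit_disc \<Longrightarrow> f z = 0" "0 \<le> t" "z \<in> unit_disc"
  shows "F t z = z"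
  using flow_unique[of t "\<lambda>_. z"] assms by (simp add: image_subset_iff)

end

section \<open>Commuting semigroups\<close>

text \<open>The numerator of the derivative of \<open>f / g\<close> is the Lie commutator, so the
  quotient is constant on a ball around \<open>z0\<close> where \<open>g\<close> has no
  zero.\<close>

lemma proportional_of_lie_commutator_zero:
  assumes f: "f holomorphic_on unit_disc" and g: "g holomorphic_on unit_disc"
    and lie: "\<And>z. z \<in> unit_disc \<Longrightarrow> lie_commutator f g z = 0"
    and z0: "z0 \<in> unit_disc" "g z0 \<noteq> 0"
  obtains \<alpha> where "\<And>z. z \<in> unit_disc \<Longrightarrow> f z = \<alpha> * g z"
proof -
  have "isCont g z0"
    using holomorphic_on_imp_continuous_on[OF g] z0(1) by (simp add: continuous_on_eq_continuous_at)
  then obtain d where d: "0 < d" "\<And>z. dist z0 z < d \<Longrightarrow> g z \<noteq> 0"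
    using continuous_at_avoid[of z0 g 0] z0(2) by blast
  define e where "e = min d (1 - norm z0)"
  have e: "0 < e" using d z0 by (simp add: e_def)
  have sub: "ball z0 e \<subseteq> unit_disc"
  proof
    fix w assume "w \<in> ball z0 e"
    then show "w \<in> unit_disc"
      using norm_triangle_ineq2[of w z0] by (simp add: e_def dist_norm norm_minus_commute)
  qed
  have g_nz: "g z \<noteq> 0" if "z \<in> ball z0 e" for z
    using that d(2) by (simp add: e_def)
  have "((\<lambda>z. f z / g z) has_field_derivative 0) (at z within ball z0 e)" if z: "z \<in> ball z0 e" for z
  proof -
    have zd: "z \<in> unit_disc" using z sub by blast
    have "((\<lambda>z. f z / g z) has_field_derivative
        (deriv f z * g z - f z * deriv g z) / (g z * g z)) (at z)"
      using zd g_nz[OF z] by (intro DERIV_divide holomorphic_derivI[OF f] holomorphic_derivI[OF g]) auto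
    moreover have "deriv f z * g z - f z * deriv g z = 0"
      using lie[OF zd] by (simp add: lie_commutator_def mult.commute)
    ultimately have "((\<lambda>z. f z / g z) has_field_derivative 0) (at z)" by simp
    then show ?thesis by (rule has_field_derivative_at_within)
  qed
  from has_field_derivative_zero_constant[OF convex_ball this]
  obtain \<alpha> where \<alpha>: "\<And>z. z \<in> ball z0 e \<Longrightarrow> f z / g z = \<alpha>" by blast
  have "f z = \<alpha> * g z" if "z \<in> unit_disc" for z
  \<comment> \<open>The identity theorem carries the relation from the ball to the whole disc,
    across possible zeros of \<open>g\<close>.\<close>
  proof (rule analytic_continuation_open[of "ball z0 e" unit_disc f "\<lambda>w. \<alpha> * g w"])
    show "f w = \<alpha> * g w" if "w \<in> ball z0 e" for w
      using \<alpha>[OF that] g_nz[OF that] by (simp add: field_simps)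
  qed (use e sub f g that in \<open>auto intro!: holomorphic_intros\<close>)
  then show thesis by (rule that)
qed

lemma lie_commutator_swap: "lie_commutator g f z = - lie_commutator f g z"
  by (simp add: lie_commutator_def)

text \<open>The quotient \<open>(g z - g (F t z)) / t\<close> has its limit at 0 computed twice:
  through the space derivative of \<open>F t\<close>, and through the generator of composition with
  \<open>F\<close> applied to \<open>g\<close>.\<close>

lemma commuting_flows_imp_lie_commutator_zero:
  assumes "disc_semigroup F f" "disc_semigroup G g"
    and comm: "\<And>t s z. 0 \<le> t \<Longrightarrow> 0 \<le> s \<Longrightarrow> z \<in> unit_disc \<Longrightarrow> F t (G s z) = G s (F t z)"
    and z: "z \<in> unit_disc"
  shows "lie_commutator f g z = 0"
proof -
  interpret F: disc_semigroup F f by fact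
  interpret G: disc_semigroup G g by fact
  have equivariant: "deriv (F t) z * g z = g (F t z)" if t: "0 \<le> t" for t
  proof -
    have "((\<lambda>s. F t (G s z)) has_vector_derivative - g z * deriv (F t) z) (at 0 within {0..})"
      using has_vector_derivative_holomorphic_comp[OF F.flow_holomorphic[OF t] G.flow_in_disc
          G.flow_right_derivative, of 0 z] z G.flow_zero[OF z] by simp
    moreover have "((\<lambda>s. F t (G s z)) has_vector_derivative - g (F t z)) (at 0 within {0..})"
    proof (rule has_vector_derivative_transform)
      show "((\<lambda>s. G s (F t z)) has_vector_derivative - g (F t z)) (at 0 within {0..})"
        using G.flow_right_derivative[OF order_refl F.flow_in_disc[OF t z]]
          G.flow_zero[OF F.flow_in_disc[OF t z]] by simp
    qed (use z in \<open>auto simp: comm t\<close>)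
    ultimately have "- g z * deriv (F t) z = - g (F t z)"
      by (rule vector_derivative_unique_within[rotated]) (simp add: at_within_Ici_at_right)
    then show ?thesis by (simp add: mult.commute)
  qed
  have "((\<lambda>t. (1 - deriv (F t) z) / of_real t * g z) \<longlongrightarrow> deriv f z * g z) (at_right 0)"
    by (intro tendsto_mult_right F.flow_space_derivative_tendsto z)
  then have "((\<lambda>t. (g z - g (F t z)) / of_real t) \<longlongrightarrow> deriv f z * g z) (at_right 0)"
  proof (rule Lim_transform_eventually)
    show "\<forall>\<^sub>F t in at_right 0. (1 - deriv (F t) z) / of_real t * g z = (g z - g (F t z)) / of_real t"
      by (intro eventually_at_rightI[of 0 1])
         (auto simp: left_diff_distrib diff_divide_distrib simp flip: equivariant)
  qed
  moreover have "((\<lambda>t. (g z - g (F t z)) / of_real t) \<longlongrightarrow> deriv g z * f z) (at_right 0)"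
  proof -
    have "uniform_limit {z} (\<lambda>t z. (g z - g (F t z)) / of_real t) (\<lambda>z. deriv g z * f z) (at_right 0)"
      using F.composition_generator[unfolded linear_semigroup_generator_def Hol_disc_def
          composition_semigroup_def Gamma_op_def o_def, rule_format, of g "{z}"]
        G.generator_holomorphic z by simp
    then show ?thesis by (rule tendsto_uniform_limitI) simp
  qed
  ultimately show ?thesis
    using tendsto_unique[OF trivial_limit_at_right_real] by (fastforce simp: lie_commutator_def)
qed

lemma lie_commutator_zero_imp_commuting_flows:
  assumes "disc_semigroup F f" "disc_semigroup G g"
    and lie: "\<And>z. z \<in> unit_disc \<Longrightarrow> lie_commutator f g z = 0"
    and t: "0 \<le> t" and s: "0 \<le> s" and z: "z \<in> unit_disc"
  shows "F t (G s z) = G s (F t z)"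
proof -
  interpret F: disc_semigroup F f by fact
  interpret G: disc_semigroup G g by fact
  show ?thesis
  proof (cases "\<forall>z\<in>unit_disc. f z = 0")
    case True
    then show ?thesis
      using F.flow_trivial t z G.flow_in_disc[OF s z] by simp
  next
    case False
    \<comment> \<open>The roles of \<open>f\<close> and \<open>g\<close> are exchanged here:
      dividing by the nonzero \<open>f\<close> expresses \<open>g\<close> through the generator of
      \<open>F\<close>.\<close>
    then obtain \<beta> where \<beta>: "\<And>z. z \<in> unit_disc \<Longrightarrow> g z = \<beta> * f z"
      using proportional_of_lie_commutator_zero[OF G.generator_holomorphic F.generator_holomorphic] lie
      by (metis lie_commutator_swap neg_0_equal_iff_equal)
    \<comment> \<open>The relation \<open>F.flow_generator_equivariant\<close> is linear in the
      vector field, so it passes from \<open>f\<close> to its multiple \<open>g\<close>.\<close>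
    have equivariant: "deriv (F t) w * g w = g (F t w)" if "w \<in> unit_disc" for w
      using F.flow_generator_equivariant[OF t that] \<beta> that F.flow_in_disc[OF t that]
      by (metis mult.left_commute)
    have "F t (G s z) = G s (F t (G 0 z))"
    proof (rule G.flow_unique[OF s])
      have "continuous_on unit_disc (F t)"
        using F.flow_holomorphic[OF t] by (rule holomorphic_on_imp_continuous_on)
      then show "continuous_on {0..s} (\<lambda>x. F t (G x z))"
        by (rule continuous_on_compose2)
           (use z G.flow_in_disc in \<open>auto intro: continuous_on_subset[OF G.flow_continuous_in_time]\<close>)
      show "(\<lambda>x. F t (G x z)) ` {0..s} \<subseteq> unit_disc"
        using F.flow_in_disc[OF t G.flow_in_disc[OF _ z]] by auto
      fix x assume x: "0 \<le> x" "x < s"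
      show "((\<lambda>x. F t (G x z)) has_vector_derivative - g (F t (G x z))) (at x within {x..})"
        using has_vector_derivative_holomorphic_comp[OF F.flow_holomorphic[OF t] G.flow_in_disc
            G.flow_right_derivative, of x z] x z equivariant[OF G.flow_in_disc[OF x(1) z]]
        by (simp add: mult.commute)
    qed
    then show ?thesis using G.flow_zero[OF z] by simp
  qed
qed

section \<open>Commutation of composition operators and of their generators\<close>

lemma operators_commute_composition_iff:
  assumes F: "F t ` unit_disc \<subseteq> unit_disc" and G: "G s ` unit_disc \<subseteq> unit_disc"
  shows "operators_commute (composition_semigroup F t) (composition_semigroup G s) \<longleftrightarrow>
    (\<forall>z\<in>unit_disc. F t (G s z) = G s (F t z))"
proof
  assume "operators_commute (composition_semigroup F t) (composition_semigroup G s)"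
  \<comment> \<open>The identity as test function recovers the maps; composition operators reverse
    their order.\<close>
  then have "\<forall>z\<in>unit_disc. (id \<circ> G s \<circ> F t) z = (id \<circ> F t \<circ> G s) z"
    unfolding operators_commute_def composition_semigroup_def Hol_disc_def
    using holomorphic_on_id by blast
  then show "\<forall>z\<in>unit_disc. F t (G s z) = G s (F t z)" by simp
qed (simp add: operators_commute_def composition_semigroup_def)

text \<open>Both products contain the same second-order term \<open>h'' f g\<close>; it cancels, and
  only a multiple of \<open>deriv h z\<close> survives.\<close>

lemma Gamma_op_commutator:
  assumes f: "f holomorphic_on unit_disc" and g: "g holomorphic_on unit_disc"
    and h: "h holomorphic_on unit_disc" and z: "z \<in> unit_disc"
  shows "Gamma_op f (Gamma_op g h) z - Gamma_op g (Gamma_op f h) z = - deriv h z * lie_commutator f g z"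
proof -
  have product: "deriv (\<lambda>w. deriv h w * k w) z = deriv h z * deriv k z + deriv (deriv h) z * k z"
    if "k holomorphic_on unit_disc" for k
    using z that h
    by (intro DERIV_imp_deriv DERIV_mult' holomorphic_derivI[of _ unit_disc] holomorphic_deriv) auto
  show ?thesis
    unfolding Gamma_op_def lie_commutator_def product[OF f] product[OF g] by (simp add: algebra_simps)
qed

lemma operators_commute_Gamma_op_iff:
  assumes f: "f holomorphic_on unit_disc" and g: "g holomorphic_on unit_disc"
  shows "operators_commute (Gamma_op f) (Gamma_op g) \<longleftrightarrow> (\<forall>z\<in>unit_disc. lie_commutator f g z = 0)"
proof
  assume *: "operators_commute (Gamma_op f) (Gamma_op g)"
  show "\<forall>z\<in>unit_disc. lie_commutator f g z = 0"
  proof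
    fix z assume z: "z \<in> unit_disc"
    \<comment> \<open>The identity has derivative 1, so it exposes the Lie commutator
      itself.\<close>
    have "(\<lambda>w. w) \<in> Hol_disc" by (simp add: Hol_disc_def)
    then have "Gamma_op f (Gamma_op g (\<lambda>w. w)) z = Gamma_op g (Gamma_op f (\<lambda>w. w)) z"
      using * z unfolding operators_commute_def by blast
    then show "lie_commutator f g z = 0"
      using Gamma_op_commutator[OF f g holomorphic_on_ident z] by simp
  qed
next
  assume "\<forall>z\<in>unit_disc. lie_commutator f g z = 0"
  then show "operators_commute (Gamma_op f) (Gamma_op g)"
    using Gamma_op_commutator[OF f g] by (simp add: operators_commute_def Hol_disc_def)
qed

lemma lie_commutator_proportional:
  assumes g: "g holomorphic_on unit_disc" and scaled: "\<And>z. z \<in> unit_disc \<Longrightarrow> f z = \<alpha> * g z"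
    and z: "z \<in> unit_disc"
  shows "lie_commutator f g z = 0"
proof -
  have "((\<lambda>w. \<alpha> * g w) has_field_derivative \<alpha> * deriv g z) (at z)"
    by (intro DERIV_cmult holomorphic_derivI[OF g open_ball z])
  then have "(f has_field_derivative \<alpha> * deriv g z) (at z)"
    by (rule has_field_derivative_transform_within_open[OF _ open_ball z]) (simp add: scaled)
  then have "deriv f z = \<alpha> * deriv g z" by (rule DERIV_imp_deriv)
  then show ?thesis using scaled[OF z] by (simp add: lie_commutator_def)
qed

text \<open>If \<open>g\<close> vanishes on the disc, \<open>iv\<close> holds for every
  \<open>f\<close> while \<open>v\<close> forces \<open>f\<close> to vanish; hence \<open>iv\<close>
  yields \<open>v\<close> only for nonzero \<open>g\<close>. The link between \<open>ii\<close> and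
  \<open>iii\<close> passes through the flows and the Lie commutator.\<close>

theorem theorem4:
  fixes F G :: "real \<Rightarrow> complex \<Rightarrow> complex" and f g :: "complex \<Rightarrow> complex"
  assumes "one_param_semigroup F" and "one_param_semigroup G"
    and "f \<in> Hol_disc" and "g \<in> Hol_disc"
    and "semigroup_generator F f" and "semigroup_generator G g"
  defines "A \<equiv> composition_semigroup F" and "B \<equiv> composition_semigroup G"
  defines "i \<equiv> \<forall>t\<ge>0. \<forall>s\<ge>0. \<forall>z\<in>unit_disc. F t (G s z) = G s (F t z)"
    and "ii \<equiv> \<forall>t\<ge>0. \<forall>s\<ge>0. operators_commute (A t) (B s)"
    and "iii \<equiv> operators_commute (Gamma_op f) (Gamma_op g)"
    and "iv \<equiv> \<forall>z\<in>unit_disc. lie_commutator f g z = 0"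
    and "v \<equiv> \<exists>\<alpha>::complex. \<forall>z\<in>unit_disc. f z = \<alpha> * g z"
  shows "linear_semigroup_generator A (Gamma_op f) \<and>
    linear_semigroup_generator B (Gamma_op g) \<and>
    (i \<longleftrightarrow> ii) \<and> (ii \<longleftrightarrow> iii) \<and> (iii \<longleftrightarrow> iv) \<and>
    (v \<longrightarrow> iv) \<and> ((\<exists>z\<in>unit_disc. g z \<noteq> 0) \<longrightarrow> (iv \<longleftrightarrow> v))"
proof -
  interpret F: disc_semigroup F f
    using assms(1,3,5) unfolding Hol_disc_def by (intro disc_semigroup.intro) simp_all
  interpret G: disc_semigroup G g
    using assms(2,4,6) unfolding Hol_disc_def by (intro disc_semigroup.intro) simp_all
  have i_ii: "i \<longleftrightarrow> ii"
    unfolding i_def ii_def A_def B_def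
    by (simp add: operators_commute_composition_iff F.flow_maps G.flow_maps)
  have iii_iv: "iii \<longleftrightarrow> iv"
    unfolding iii_def iv_def
    by (rule operators_commute_Gamma_op_iff[OF F.generator_holomorphic G.generator_holomorphic])
  have i_iv: "i \<longleftrightarrow> iv"
    unfolding i_def iv_def
    using commuting_flows_imp_lie_commutator_zero[OF F.disc_semigroup_axioms G.disc_semigroup_axioms]
      lie_commutator_zero_imp_commuting_flows[OF F.disc_semigroup_axioms G.disc_semigroup_axioms]
    by blast
  have v_iv: "v \<longrightarrow> iv"
    unfolding v_def iv_def using lie_commutator_proportional[OF G.generator_holomorphic] by blast
  have iv_v: "(\<exists>z\<in>unit_disc. g z \<noteq> 0) \<longrightarrow> iv \<longrightarrow> v"
    unfolding v_def iv_def
    using proportional_of_lie_commutator_zero[OF F.generator_holomorphic G.generator_holomorphic]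
    by metis
  show ?thesis
    using F.composition_generator G.composition_generator i_ii iii_iv i_iv v_iv iv_v
    unfolding A_def B_def by blast
qed

end
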